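(* Let $\mathbb{X}=(X_t)_{t\ge0}$ be a Feller process in a Polish space $E$ with semigroup $(S_t)_{t\ge0}$. The following two statements are equivalent: (a) The generalized coupling time $h$ with respect to the discrete metric $\rho(x,y)=\mathbf{1}_{x\ne y}$ is uniformly bounded, i.e. there is $M<\infty$ with $h(x,y)\le M$ for all $x,y\in E$; (b) The semigroup is eventually contractive in the oscillation (semi)norm, i.e. $\|S_T\|_{osc}<1$ for some $T>0$.
   Context: The optimal coupling distance at time $t$ is $\rho_t(x,y):=\inf_{\pi}\int\rho(x',y')\,\pi(dx'dy')$, where the infimum ranges over all couplings $\pi$ of the marginals $\delta_xS_t$ and $\delta_yS_t$, the distributions of $X_t$ started from $x$ and $y$ respectively; the generalized coupling time with respect to $\rho$ is $h(x,y):=\int_0^\infty\rho_t(x,y)\,dt$. The oscillation seminorm is $\|f\|_{osc}:=\sup_{x,y\in E}(f(x)-f(y))$, and $\|S_T\|_{osc}:=\sup_{\|f\|_{osc}=1}\|S_Tf\|_{osc}$, where $S_Tf(x)=\mathbb{E}_xf(X_T)$. *)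

theory Defs
  imports "HOL-Probability.Probability"
begin

text \<open>
  A Markov process with state space \<open>'e\<close> is given by a measurable space \<open>\<Omega>\<close>, a family \<open>P x\<close> of
  probability measures on \<open>\<Omega>\<close> (the law of the process started from \<open>x\<close>) and maps \<open>X t\<close> on \<open>\<Omega>\<close>.
  Time is of type \<open>real\<close>; only times \<open>t \<ge> 0\<close> are meaningful.
\<close>

definition law_at :: "('e \<Rightarrow> 'w measure) \<Rightarrow> (real \<Rightarrow> 'w \<Rightarrow> 'e::topological_space)
    \<Rightarrow> real \<Rightarrow> 'e \<Rightarrow> 'e measure" where
  "law_at P X t x = distr (P x) borel (X t)"

definition semigroup_of :: "('e \<Rightarrow> 'w measure) \<Rightarrow> (real \<Rightarrow> 'w \<Rightarrow> 'e)
    \<Rightarrow> real \<Rightarrow> ('e \<Rightarrow> real) \<Rightarrow> 'e \<Rightarrow> real" where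
  "semigroup_of P X t f x = (\<integral>\<omega>. f (X t \<omega>) \<partial>P x)"

definition natural_filtration :: "'w measure \<Rightarrow> (real \<Rightarrow> 'w \<Rightarrow> 'e::topological_space)
    \<Rightarrow> real \<Rightarrow> 'w measure" where
  "natural_filtration \<Omega> X s =
     sigma (space \<Omega>) {X r -` A \<inter> space \<Omega> | r A. 0 \<le> r \<and> r \<le> s \<and> A \<in> sets borel}"

locale markov_process =
  fixes \<Omega> :: "'w measure"
    and P :: "'e::polish_space \<Rightarrow> 'w measure"
    and X :: "real \<Rightarrow> 'w \<Rightarrow> 'e"
  assumes prob: "\<And>x. prob_space (P x)"
    and sets_P: "\<And>x. sets (P x) = sets \<Omega>"
    and measurable_X: "\<And>t. 0 \<le> t \<Longrightarrow> X t \<in> \<Omega> \<rightarrow>\<^sub>M borel"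
    and start: "\<And>x. AE \<omega> in P x. X 0 \<omega> = x"
    and measurable_law: "\<And>t. 0 \<le> t \<Longrightarrow> law_at P X t \<in> borel \<rightarrow>\<^sub>M prob_algebra borel"
    and markov: "\<And>x s t f. 0 \<le> s \<Longrightarrow> 0 \<le> t \<Longrightarrow> f \<in> borel_measurable borel \<Longrightarrow> bounded (range f) \<Longrightarrow>
      AE \<omega> in P x. real_cond_exp (P x) (natural_filtration \<Omega> X s) (\<lambda>\<omega>'. f (X (s + t) \<omega>')) \<omega>
        = semigroup_of P X t f (X s \<omega>)"

text \<open>
  A Polish space need not be locally compact, so the Feller property refers to bounded continuous
  functions instead of continuous functions vanishing at infinity. Continuity of the semigroup at
  time 0 is required pointwise only; it holds automatically for right-continuous paths, so
  processes with cadlag paths are covered.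
\<close>

locale feller_process = markov_process +
  assumes feller: "\<And>t f. 0 \<le> t \<Longrightarrow> continuous_on UNIV f \<Longrightarrow> bounded (range f) \<Longrightarrow>
      continuous_on UNIV (semigroup_of P X t f)"
    and continuous_at_0: "\<And>f x. continuous_on UNIV f \<Longrightarrow> bounded (range f) \<Longrightarrow>
      ((\<lambda>t. semigroup_of P X t f x) \<longlongrightarrow> f x) (at_right 0)"

definition couplings :: "'a measure \<Rightarrow> 'b measure \<Rightarrow> ('a \<times> 'b) measure set" where
  "couplings \<mu> \<nu> = {\<pi>. sets \<pi> = sets (\<mu> \<Otimes>\<^sub>M \<nu>) \<and> distr \<pi> \<mu> fst = \<mu> \<and> distr \<pi> \<nu> snd = \<nu>}"

definition optimal_coupling_distance :: "('e \<Rightarrow> 'w measure) \<Rightarrow> (real \<Rightarrow> 'w \<Rightarrow> 'e::topological_space)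
    \<Rightarrow> ('e \<Rightarrow> 'e \<Rightarrow> real) \<Rightarrow> real \<Rightarrow> 'e \<Rightarrow> 'e \<Rightarrow> ennreal" where
  "optimal_coupling_distance P X \<rho> t x y =
     (INF \<pi> \<in> couplings (law_at P X t x) (law_at P X t y). \<integral>\<^sup>+ z. ennreal (\<rho> (fst z) (snd z)) \<partial>\<pi>)"

definition generalized_coupling_time :: "('e \<Rightarrow> 'w measure) \<Rightarrow> (real \<Rightarrow> 'w \<Rightarrow> 'e::topological_space)
    \<Rightarrow> ('e \<Rightarrow> 'e \<Rightarrow> real) \<Rightarrow> 'e \<Rightarrow> 'e \<Rightarrow> ennreal" where
  "generalized_coupling_time P X \<rho> x y =
     (\<integral>\<^sup>+ t \<in> {0..}. optimal_coupling_distance P X \<rho> t x y \<partial>lborel)"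

definition discrete_dist :: "'a \<Rightarrow> 'a \<Rightarrow> real" where
  "discrete_dist x y = (if x \<noteq> y then 1 else 0)"

text \<open>
  The truncation of negative values by \<open>ennreal\<close> does not change the supremum, which is
  nonnegative because of the pairs \<open>x = y\<close>.
\<close>

definition osc :: "('e \<Rightarrow> real) \<Rightarrow> ennreal" where
  "osc f = (SUP x. SUP y. ennreal (f x - f y))"

text \<open>
  For a one-point space no function has oscillation 1 and the norm is \<open>0\<close>, the supremum of the
  empty set in \<open>ennreal\<close>.
\<close>

definition osc_norm :: "(('e::topological_space \<Rightarrow> real) \<Rightarrow> 'e \<Rightarrow> real) \<Rightarrow> ennreal" where
  "osc_norm T = (SUP f \<in> {f. f \<in> borel_measurable borel \<and> osc f = 1}. osc (T f))"

end

theory Submission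
  imports Defs
begin

text \<open>
  For the discrete metric the cost of a coupling is the mass it puts off the diagonal, and the
  smallest possible cost \<open>tv t x y\<close> is the total variation distance of the laws at time \<open>t\<close>. It is
  linked to the semigroup by two estimates in opposite directions.

    \<^item> Every coupling of \<open>\<mu>\<close> and \<open>\<nu>\<close> bounds \<open>\<integral>f d\<mu> - \<integral>f d\<nu>\<close> by the oscillation of \<open>f\<close> times its cost
      (\<open>coupling_inequality\<close>, \<open>semigroup_diff_le_tv\<close>).
    \<^item> Some coupling costs at most \<open>\<mu> Y - \<nu> Y\<close> for a Borel set \<open>Y\<close> (\<open>maximal_coupling\<close>,
      \<open>tv_le_semigroup_diff\<close>), so \<open>tv\<close> is controlled by the semigroup acting on indicators.

  Together with \<open>S_(s+t) = S_s S_t\<close>, which is the Markov property in the mean, they give the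
  inequality \<open>tv_add_le\<close>: if \<open>S_t\<close> maps indicators to functions of oscillation at most \<open>c\<close>, then
  \<open>tv (s + t) \<le> c * tv s\<close>.

  With \<open>c = 1\<close> this says that \<open>tv\<close> is nonincreasing in time. Hence \<open>T * tv T\<close> is at most the
  integral of \<open>tv\<close>, and a uniform bound \<open>M\<close> on that integral forces \<open>tv T \<le> 1 / 2\<close> as soon as
  \<open>T \<ge> 2 * M\<close>; the first estimate turns this into \<open>osc_norm (S_T) \<le> 1 / 2\<close>.
  Conversely, if \<open>c = osc_norm (S_T) < 1\<close>, iteration gives \<open>tv (n * T) \<le> c ^ n\<close>, and by monotonicity
  the integral of \<open>tv\<close> is at most \<open>T\<close> times a geometric series.

  In both directions the function \<open>t \<mapsto> tv t x y\<close> is compared with a step function in \<open>t\<close>, and the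
  nonnegative integral respects such pointwise comparisons.
\<close>

section \<open>Maximal couplings\<close>

definition add_measure :: "'a measure \<Rightarrow> 'a measure \<Rightarrow> 'a measure" where
  "add_measure M N = measure_of (space M) (sets M) (\<lambda>A. emeasure M A + emeasure N A)"

lemma sets_add_measure [simp]: "sets (add_measure M N) = sets M"
  by (simp add: add_measure_def)

lemma emeasure_add_measure:
  assumes "sets N = sets M" "A \<in> sets M"
  shows "emeasure (add_measure M N) A = emeasure M A + emeasure N A"
  unfolding add_measure_def
proof (rule emeasure_measure_of_sigma)
  show "sigma_algebra (space M) (sets M)" ..
  show "positive (sets M) (\<lambda>A. emeasure M A + emeasure N A)"
    by (simp add: positive_def)
  show "countably_additive (sets M) (\<lambda>A. emeasure M A + emeasure N A)"
  proof (rule countably_additiveI)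
    fix A :: "nat \<Rightarrow> 'a set"
    assume "range A \<subseteq> sets M" "disjoint_family A" "(\<Union>i. A i) \<in> sets M"
    then show "(\<Sum>i. emeasure M (A i) + emeasure N (A i))
        = emeasure M (\<Union>i. A i) + emeasure N (\<Union>i. A i)"
      using assms(1) by (simp add: suminf_add [symmetric] suminf_emeasure)
  qed
qed (use assms in auto)

text \<open>
  In a second countable Hausdorff space the diagonal is closed, hence measurable for the product of
  the Borel \<open>\<sigma>\<close>-algebras. This is what makes the cost of a coupling the measure of a set.
\<close>

lemma nn_integral_discrete_dist:
  fixes \<pi> :: "('a::{second_countable_topology, t2_space} \<times> 'a) measure"
  assumes "sets \<pi> = sets (borel \<Otimes>\<^sub>M borel)"
  shows "(\<integral>\<^sup>+ z. ennreal (discrete_dist (fst z) (snd z)) \<partial>\<pi>) = emeasure \<pi> {z. fst z \<noteq> snd z}"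
    and "{z. fst z \<noteq> snd z} \<in> sets \<pi>"
proof -
  have "{z :: 'a \<times> 'a. fst z \<noteq> snd z} = - {y. \<exists>x. y = (x, x)}"
    by auto
  also have "\<dots> \<in> sets borel"
    using closed_diagonal by (intro borel_comp borel_closed) auto
  finally show *: "{z. fst z \<noteq> snd z} \<in> sets \<pi>"
    unfolding assms by (simp only: borel_prod)
  have "(\<integral>\<^sup>+ z. ennreal (discrete_dist (fst z) (snd z)) \<partial>\<pi>)
      = (\<integral>\<^sup>+ z. indicator {z. fst z \<noteq> snd z} z \<partial>\<pi>)"
    by (intro nn_integral_cong) (auto simp: discrete_dist_def indicator_def)
  also have "\<dots> = emeasure \<pi> {z. fst z \<noteq> snd z}"
    using * by simp
  finally show "(\<integral>\<^sup>+ z. ennreal (discrete_dist (fst z) (snd z)) \<partial>\<pi>)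
      = emeasure \<pi> {z. fst z \<noteq> snd z}" .
qed

text \<open>
  The measure \<open>m\<close> is the infimum of \<open>\<mu>\<close> and \<open>\<nu>\<close>, and \<open>\<alpha>\<close>, \<open>\<beta>\<close> are the excesses of \<open>\<mu>\<close> and of \<open>\<nu>\<close>
  over it. For a Hahn set \<open>Y\<close> of \<open>\<mu> - \<nu>\<close> the infimum is \<open>\<nu>\<close> on \<open>Y\<close> and \<open>\<mu>\<close> off \<open>Y\<close>, so that \<open>\<alpha>\<close> is
  \<open>\<mu> - \<nu>\<close> on \<open>Y\<close> and \<open>\<beta>\<close> is \<open>\<nu> - \<mu>\<close> off \<open>Y\<close>.
\<close>

lemma overlap_decomposition:
  assumes "prob_space \<mu>" "prob_space \<nu>" and sets_eq: "sets \<nu> = sets \<mu>"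
  obtains Y m \<alpha> \<beta> where "Y \<in> sets \<mu>"
    and "sets m = sets \<mu>" "sets \<alpha> = sets \<mu>" "sets \<beta> = sets \<mu>"
    and "\<And>A. A \<in> sets \<mu> \<Longrightarrow> emeasure m A + emeasure \<alpha> A = emeasure \<mu> A"
    and "\<And>A. A \<in> sets \<mu> \<Longrightarrow> emeasure m A + emeasure \<beta> A = emeasure \<nu> A"
    and "emeasure \<alpha> (space \<mu>) = ennreal (measure \<mu> Y - measure \<nu> Y)"
proof -
  interpret \<mu>: prob_space \<mu> by fact
  interpret \<nu>: prob_space \<nu> by fact
  obtain Y where Y [measurable]: "Y \<in> sets \<mu>"
    and in_Y: "\<And>A. A \<in> sets \<mu> \<Longrightarrow> A \<subseteq> Y \<Longrightarrow> emeasure \<nu> A \<le> emeasure \<mu> A"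
    and off_Y: "\<And>A. A \<in> sets \<mu> \<Longrightarrow> A \<inter> Y = {} \<Longrightarrow> emeasure \<mu> A \<le> emeasure \<nu> A"
    using finite_unsigned_Hahn_decomposition
      [OF \<mu>.finite_measure_axioms \<nu>.finite_measure_axioms sets_eq] by blast
  define cut where "cut \<kappa> B = density \<kappa> (indicator B)" for \<kappa> :: "'a measure" and B
  have sets_cut [simp]: "sets (cut \<kappa> B) = sets \<kappa>" for \<kappa> B
    by (simp add: cut_def)
  have cut: "emeasure (cut \<kappa> B) A = emeasure \<kappa> (A \<inter> B)"
    if "sets \<kappa> = sets \<mu>" "A \<in> sets \<mu>" "B \<in> sets \<mu>" for \<kappa> A B
    unfolding cut_def using that
    by (simp add: emeasure_density Int_commute flip: indicator_inter_arith)
  have fin: "finite_measure (cut \<kappa> B)" if "prob_space \<kappa>" "sets \<kappa> = sets \<mu>" "B \<in> sets \<mu>" for \<kappa> B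
  proof
    interpret prob_space \<kappa> by fact
    show "emeasure (cut \<kappa> B) (space (cut \<kappa> B)) \<noteq> \<infinity>"
      using that cut[of \<kappa> "space \<mu>" B] sets_eq_imp_space_eq[OF that(2)]
      by (simp add: cut_def)
  qed
  have split: "emeasure \<kappa> (A \<inter> Y) + emeasure \<kappa> (A \<inter> (space \<mu> - Y)) = emeasure \<kappa> A"
    if "sets \<kappa> = sets \<mu>" "A \<in> sets \<mu>" for \<kappa> A
  proof -
    have "A = (A \<inter> Y) \<union> (A \<inter> (space \<mu> - Y))"
      using sets.sets_into_space[OF that(2)] by auto
    moreover have "emeasure \<kappa> ((A \<inter> Y) \<union> (A \<inter> (space \<mu> - Y)))
        = emeasure \<kappa> (A \<inter> Y) + emeasure \<kappa> (A \<inter> (space \<mu> - Y))"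
      using that by (intro plus_emeasure [symmetric]) auto
    ultimately show ?thesis by simp
  qed
  define m where "m = add_measure (cut \<mu> (space \<mu> - Y)) (cut \<nu> Y)"
  define \<alpha> where "\<alpha> = diff_measure (cut \<mu> Y) (cut \<nu> Y)"
  define \<beta> where "\<beta> = diff_measure (cut \<nu> (space \<mu> - Y)) (cut \<mu> (space \<mu> - Y))"
  have m: "emeasure m A = emeasure \<mu> (A \<inter> (space \<mu> - Y)) + emeasure \<nu> (A \<inter> Y)"
    if "A \<in> sets \<mu>" for A
    unfolding m_def using that by (simp add: emeasure_add_measure cut sets_eq)
  have \<alpha>: "emeasure \<alpha> A = emeasure \<mu> (A \<inter> Y) - emeasure \<nu> (A \<inter> Y)" if "A \<in> sets \<mu>" for A
    unfolding \<alpha>_def using that assms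
    by (subst emeasure_diff_measure) (auto simp: cut sets_eq intro!: fin in_Y)
  have \<beta>: "emeasure \<beta> A = emeasure \<nu> (A \<inter> (space \<mu> - Y)) - emeasure \<mu> (A \<inter> (space \<mu> - Y))"
    if "A \<in> sets \<mu>" for A
    unfolding \<beta>_def using that assms
    by (subst emeasure_diff_measure) (auto simp: cut sets_eq intro!: fin off_Y)
  show ?thesis
  proof (rule that[of Y m \<alpha> \<beta>])
    show "Y \<in> sets \<mu>" by fact
    show "sets m = sets \<mu>" "sets \<alpha> = sets \<mu>" "sets \<beta> = sets \<mu>"
      by (simp_all add: m_def \<alpha>_def \<beta>_def sets_eq)
  next
    fix A assume A: "A \<in> sets \<mu>"
    have inv_Y: "emeasure \<nu> (A \<inter> Y) + (emeasure \<mu> (A \<inter> Y) - emeasure \<nu> (A \<inter> Y)) = emeasure \<mu> (A \<inter> Y)"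
      using A by (intro add_diff_inverse_ennreal in_Y) auto
    show "emeasure m A + emeasure \<alpha> A = emeasure \<mu> A"
      unfolding m[OF A] \<alpha>[OF A] add.assoc inv_Y
      using split[of \<mu> A] A by (simp add: add.commute)
    have inv_Yc: "emeasure \<mu> (A \<inter> (space \<mu> - Y))
        + (emeasure \<nu> (A \<inter> (space \<mu> - Y)) - emeasure \<mu> (A \<inter> (space \<mu> - Y)))
        = emeasure \<nu> (A \<inter> (space \<mu> - Y))"
      using A by (intro add_diff_inverse_ennreal off_Y) auto
    show "emeasure m A + emeasure \<beta> A = emeasure \<nu> A"
      unfolding m[OF A] \<beta>[OF A] add.commute[of "emeasure \<mu> _"] add.assoc
      unfolding add.commute[of _ "emeasure \<mu> _"] inv_Yc
      using split[of \<nu> A] A sets_eq by simp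
  next
    have "space \<mu> \<inter> Y = Y"
      using sets.sets_into_space[OF Y] by auto
    then show "emeasure \<alpha> (space \<mu>) = ennreal (measure \<mu> Y - measure \<nu> Y)"
      by (simp add: \<alpha> \<mu>.emeasure_eq_measure \<nu>.emeasure_eq_measure ennreal_minus)
  qed
qed

text \<open>
  Leave the common part \<open>m\<close> of the two laws on the diagonal and couple the excesses \<open>\<alpha>\<close> and \<open>\<beta>\<close>
  independently. Both excesses have the same mass \<open>d = \<mu> Y - \<nu> Y\<close>, so that the product has to be
  scaled by \<open>1 / d\<close> to have them as its marginals. Only this second part, of total mass \<open>d\<close>, can
  leave the diagonal.
\<close>

lemma maximal_coupling:
  fixes \<mu> \<nu> :: "'a::{second_countable_topology, t2_space} measure"
  assumes "prob_space \<mu>" "prob_space \<nu>" and sets_\<mu>: "sets \<mu> = sets borel" and sets_\<nu>: "sets \<nu> = sets borel"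
  obtains Y \<pi> where "Y \<in> sets borel" "\<pi> \<in> couplings \<mu> \<nu>"
    "emeasure \<pi> {z. fst z \<noteq> snd z} \<le> ennreal (measure \<mu> Y - measure \<nu> Y)"
proof -
  interpret \<mu>: prob_space \<mu> by fact
  interpret \<nu>: prob_space \<nu> by fact
  obtain Y m \<alpha> \<beta> where Y: "Y \<in> sets \<mu>"
    and sets_m: "sets m = sets \<mu>" and sets_\<alpha>: "sets \<alpha> = sets \<mu>" and sets_\<beta>: "sets \<beta> = sets \<mu>"
    and m\<alpha>: "\<And>A. A \<in> sets \<mu> \<Longrightarrow> emeasure m A + emeasure \<alpha> A = emeasure \<mu> A"
    and m\<beta>: "\<And>A. A \<in> sets \<mu> \<Longrightarrow> emeasure m A + emeasure \<beta> A = emeasure \<nu> A"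
    and mass: "emeasure \<alpha> (space \<mu>) = ennreal (measure \<mu> Y - measure \<nu> Y)"
    using overlap_decomposition[OF assms(1,2)] sets_\<mu> sets_\<nu> by metis
  have sp: "space \<mu> = UNIV" "space \<nu> = UNIV" "space m = UNIV" "space \<alpha> = UNIV" "space \<beta> = UNIV"
    using sets_\<mu> sets_\<nu> sets_m sets_\<alpha> sets_\<beta> by (auto dest!: sets_eq_imp_space_eq)
  note [measurable_cong] = sets_\<mu> sets_\<nu> sets_m sets_\<alpha> sets_\<beta>
  define d where "d = emeasure \<alpha> UNIV"
  have d_fin: "d \<noteq> \<infinity>"
    using mass by (simp add: d_def sp)
  have total: "emeasure m UNIV + d = 1" "emeasure m UNIV + emeasure \<beta> UNIV = 1"
    using m\<alpha>[of UNIV] m\<beta>[of UNIV] sets_\<mu> \<mu>.emeasure_space_1 \<nu>.emeasure_space_1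
    by (simp_all add: sp d_def)
  have m_fin: "emeasure m UNIV \<noteq> \<infinity>"
    using total(1) by (auto simp: top_add)
  have \<beta>_mass: "emeasure \<beta> UNIV = d"
    using total m_fin by (metis ennreal_add_left_cancel infinity_ennreal_def)
  interpret \<alpha>: finite_measure \<alpha>
    using d_fin by (intro finite_measureI) (simp add: sp d_def)
  interpret \<beta>: finite_measure \<beta>
    using d_fin \<beta>_mass by (intro finite_measureI) (simp add: sp)
  define \<Delta> :: "'a \<Rightarrow> 'a \<times> 'a" where "\<Delta> x = (x, x)" for x
  have \<Delta> [measurable]: "\<Delta> \<in> m \<rightarrow>\<^sub>M borel \<Otimes>\<^sub>M borel"
    unfolding \<Delta>_def by measurable
  define diag where "diag = distr m (borel \<Otimes>\<^sub>M borel) \<Delta>"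
  define rest where "rest = scale_measure (1 / d) (\<alpha> \<Otimes>\<^sub>M \<beta>)"
  define \<pi> where "\<pi> = add_measure diag rest"
  have sets_pair: "sets (\<alpha> \<Otimes>\<^sub>M \<beta>) = sets (borel \<Otimes>\<^sub>M borel)"
    using sets_\<mu> sets_\<alpha> sets_\<beta> by (intro sets_pair_measure_cong) auto
  have sets_\<pi>: "sets \<pi> = sets (borel \<Otimes>\<^sub>M borel)"
    by (simp add: \<pi>_def diag_def)
  have \<pi>: "emeasure \<pi> C = emeasure m (\<Delta> -` C) + 1 / d * emeasure (\<alpha> \<Otimes>\<^sub>M \<beta>) C"
    if "C \<in> sets (borel \<Otimes>\<^sub>M borel)" for C
    using that sets_pair
    by (simp add: \<pi>_def emeasure_add_measure diag_def rest_def emeasure_distr sp)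
  \<comment> \<open>The degenerate case \<open>d = 0\<close>, where \<open>1 / d = \<infinity>\<close>, is harmless because then both excesses vanish.\<close>
  have cancel: "1 / d * (a * d) = a" if "a \<le> d" for a
  proof (cases "d = 0")
    case True
    then show ?thesis using that by simp
  next
    case False
    then show ?thesis
      using d_fin by (simp add: ennreal_times_divide ennreal_mult_divide_eq mult.commute)
  qed
  have le_d: "emeasure \<alpha> A \<le> d" "emeasure \<beta> A \<le> d" for A
    using emeasure_space[of \<alpha> A] emeasure_space[of \<beta> A] \<beta>_mass by (simp_all add: d_def sp)
  have "distr \<pi> \<mu> fst = \<mu>"
  proof (rule measure_eqI)
    fix A assume "A \<in> sets (distr \<pi> \<mu> fst)"
    then have A: "A \<in> sets \<mu>" by simp
    have "emeasure (distr \<pi> \<mu> fst) A = emeasure \<pi> (A \<times> UNIV)"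
      using A sets_\<pi> sets_eq_imp_space_eq[OF sets_\<pi>]
      by (subst emeasure_distr) (auto intro!: arg_cong[where f = "emeasure \<pi>"] simp: space_pair_measure
          measurable_cong_sets[OF sets_\<pi> sets_\<mu>])
    also have "\<dots> = emeasure m A + 1 / d * (emeasure \<alpha> A * d)"
      using A sets_\<mu> sets_\<alpha> sets_\<beta>
      by (subst \<pi>) (auto simp: \<beta>.emeasure_pair_measure_Times \<beta>_mass \<Delta>_def vimage_def)
    also have "\<dots> = emeasure \<mu> A"
      by (simp only: cancel[OF le_d(1)] m\<alpha>[OF A])
    finally show "emeasure (distr \<pi> \<mu> fst) A = emeasure \<mu> A" .
  qed simp
  moreover have "distr \<pi> \<nu> snd = \<nu>"
  proof (rule measure_eqI)
    fix A assume "A \<in> sets (distr \<pi> \<nu> snd)"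
    then have A: "A \<in> sets \<mu>" using sets_\<mu> sets_\<nu> by simp
    have "emeasure (distr \<pi> \<nu> snd) A = emeasure \<pi> (UNIV \<times> A)"
      using A sets_\<pi> sets_\<mu> sets_\<nu> sets_eq_imp_space_eq[OF sets_\<pi>]
      by (subst emeasure_distr) (auto intro!: arg_cong[where f = "emeasure \<pi>"] simp: space_pair_measure
          measurable_cong_sets[OF sets_\<pi> sets_\<nu>])
    also have "\<dots> = emeasure m A + 1 / d * (emeasure \<beta> A * d)"
      using A sets_\<mu> sets_\<alpha> sets_\<beta>
      by (subst \<pi>) (auto simp: \<beta>.emeasure_pair_measure_Times d_def \<Delta>_def vimage_def mult.commute)
    also have "\<dots> = emeasure \<nu> A"
      by (simp only: cancel[OF le_d(2)] m\<beta>[OF A])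
    finally show "emeasure (distr \<pi> \<nu> snd) A = emeasure \<nu> A" .
  qed simp
  moreover have "sets \<pi> = sets (\<mu> \<Otimes>\<^sub>M \<nu>)"
    unfolding sets_\<pi> using sets_\<mu> sets_\<nu> by (intro sets_pair_measure_cong) auto
  ultimately have "\<pi> \<in> couplings \<mu> \<nu>"
    by (simp add: couplings_def)
  moreover have "emeasure \<pi> {z. fst z \<noteq> snd z} \<le> d"
  proof -
    have N: "{z. fst z \<noteq> snd z} \<in> sets (borel \<Otimes>\<^sub>M (borel :: 'a measure))"
      using nn_integral_discrete_dist(2)[OF sets_\<pi>] unfolding sets_\<pi> .
    have "\<Delta> -` {z. fst z \<noteq> snd z} = {}"
      by (auto simp: \<Delta>_def)
    then have "emeasure m (\<Delta> -` {z. fst z \<noteq> snd z}) = 0"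
      by (simp only: emeasure_empty)
    then have "emeasure \<pi> {z. fst z \<noteq> snd z} = 1 / d * emeasure (\<alpha> \<Otimes>\<^sub>M \<beta>) {z. fst z \<noteq> snd z}"
      by (simp only: \<pi>[OF N] add_0)
    also have "\<dots> \<le> 1 / d * emeasure (\<alpha> \<Otimes>\<^sub>M \<beta>) (UNIV \<times> UNIV)"
      using emeasure_space[of "\<alpha> \<Otimes>\<^sub>M \<beta>"] unfolding space_pair_measure sp
      by (rule mult_left_mono) simp
    also have "emeasure (\<alpha> \<Otimes>\<^sub>M \<beta>) (UNIV \<times> UNIV) = d * d"
      using sets.top[of \<alpha>] sets.top[of \<beta>] unfolding sp
      by (simp only: \<beta>.emeasure_pair_measure_Times \<beta>_mass flip: d_def)
    finally show ?thesis
      using cancel[of d] by simp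
  qed
  ultimately show ?thesis
    using Y mass sets_\<mu> by (intro that[of Y \<pi>]) (simp_all add: sp d_def)
qed

text \<open>
  The difference of the integrals is the integral of \<open>f (fst z) - f (snd z)\<close> against the coupling,
  and the integrand vanishes on the diagonal.
\<close>

lemma coupling_inequality:
  fixes \<mu> \<nu> :: "'a::{second_countable_topology, t2_space} measure"
  assumes "prob_space \<mu>" and sets_\<mu>: "sets \<mu> = sets borel" and sets_\<nu>: "sets \<nu> = sets borel"
    and \<pi>: "\<pi> \<in> couplings \<mu> \<nu>"
    and f [measurable]: "f \<in> borel_measurable borel" and bdd: "bounded (range f)"
    and osc: "\<And>x y. f x - f y \<le> c"
  shows "ennreal ((\<integral>x. f x \<partial>\<mu>) - (\<integral>x. f x \<partial>\<nu>)) \<le> ennreal c * emeasure \<pi> {z. fst z \<noteq> snd z}"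
proof -
  interpret \<mu>: prob_space \<mu> by fact
  have "sets \<pi> = sets (\<mu> \<Otimes>\<^sub>M \<nu>)" and fst: "distr \<pi> \<mu> fst = \<mu>" and snd: "distr \<pi> \<nu> snd = \<nu>"
    using \<pi> by (auto simp: couplings_def)
  moreover have "sets (\<mu> \<Otimes>\<^sub>M \<nu>) = sets (borel \<Otimes>\<^sub>M borel)"
    using sets_\<mu> sets_\<nu> by (intro sets_pair_measure_cong) auto
  ultimately have sets_\<pi> [measurable_cong]: "sets \<pi> = sets (borel \<Otimes>\<^sub>M borel)"
    by simp
  have m1 [measurable]: "fst \<in> \<pi> \<rightarrow>\<^sub>M \<mu>" and m2 [measurable]: "snd \<in> \<pi> \<rightarrow>\<^sub>M \<nu>"
    by (simp_all add: measurable_cong_sets[OF sets_\<pi> sets_\<mu>] measurable_cong_sets[OF sets_\<pi> sets_\<nu>])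
  interpret \<pi>: prob_space \<pi>
    using m1 fst \<mu>.prob_space_axioms by (metis prob_space_distrD)
  note N [measurable] = nn_integral_discrete_dist(2)[OF sets_\<pi>]
  obtain B where B: "\<And>x. \<bar>f x\<bar> \<le> B"
    using bdd by (auto simp: bounded_iff)
  have c: "0 \<le> c" using osc[of undefined undefined] by simp
  have int: "integrable \<pi> (\<lambda>z. f (fst z))" "integrable \<pi> (\<lambda>z. f (snd z))"
    by (intro \<pi>.integrable_const_bound[where B = B]; use B in simp)+
  have "(\<integral>x. f x \<partial>\<mu>) = (\<integral>z. f (fst z) \<partial>\<pi>)"
    using sets_\<mu> by (subst fst [symmetric], subst integral_distr) simp_all
  moreover have "(\<integral>x. f x \<partial>\<nu>) = (\<integral>z. f (snd z) \<partial>\<pi>)"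
    using sets_\<nu> by (subst snd [symmetric], subst integral_distr) simp_all
  ultimately have "(\<integral>x. f x \<partial>\<mu>) - (\<integral>x. f x \<partial>\<nu>) = (\<integral>z. f (fst z) - f (snd z) \<partial>\<pi>)"
    using int by simp
  also have "\<dots> \<le> (\<integral>z. c * indicator {z. fst z \<noteq> snd z} z \<partial>\<pi>)"
    using int osc N
    by (intro integral_mono integrable_mult_right integrable_real_indicator) (auto simp: \<pi>.emeasure_eq_measure split: split_indicator)
  also have "\<dots> = c * measure \<pi> {z. fst z \<noteq> snd z}"
    by simp
  finally have "ennreal ((\<integral>x. f x \<partial>\<mu>) - (\<integral>x. f x \<partial>\<nu>)) \<le> ennreal (c * measure \<pi> {z. fst z \<noteq> snd z})"
    by (rule ennreal_leI)
  then show ?thesis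
    using c by (simp add: ennreal_mult \<pi>.emeasure_eq_measure)
qed

section \<open>Coupling distance and oscillation of the semigroup\<close>

lemma osc_le_iff: "osc f \<le> ennreal c \<longleftrightarrow> (\<forall>x y. ennreal (f x - f y) \<le> ennreal c)"
  by (simp add: osc_def SUP_le_iff)

lemma bounded_range_of_osc:
  assumes "\<And>x y. f x - f y \<le> (c::real)"
  shows "bounded (range f)"
proof -
  have "norm (f x) \<le> \<bar>f undefined\<bar> + c" for x
    using assms[of x undefined] assms[of undefined x] by auto
  then show ?thesis
    by (auto simp: bounded_iff)
qed

lemma (in markov_process) prob_law:
  assumes "0 \<le> t"
  shows "prob_space (law_at P X t x)" "sets (law_at P X t x) = sets borel"
proof -
  interpret prob_space "P x" by (rule prob)
  have "X t \<in> P x \<rightarrow>\<^sub>M borel"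
    using measurable_X[OF assms] sets_P measurable_cong_sets by blast
  then show "prob_space (law_at P X t x)"
    unfolding law_at_def by (rule prob_space_distr)
qed (simp add: law_at_def)

lemma (in markov_process) semigroup_eq_integral_law:
  fixes f :: "'e \<Rightarrow> real"
  assumes "0 \<le> t" "f \<in> borel_measurable borel"
  shows "semigroup_of P X t f x = (\<integral>y. f y \<partial>law_at P X t x)"
proof -
  have "X t \<in> P x \<rightarrow>\<^sub>M borel"
    using measurable_X[OF assms(1)] sets_P measurable_cong_sets by blast
  then show ?thesis
    unfolding law_at_def semigroup_of_def using assms(2) by (subst integral_distr) auto
qed

lemma (in markov_process) semigroup_indicator_eq_measure:
  assumes t: "0 \<le> t" and Y: "Y \<in> sets borel"
  shows "semigroup_of P X t (indicator Y) x = measure (law_at P X t x) Y"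
  using Y prob_law(2)[OF t, of x] by (subst semigroup_eq_integral_law[OF t]) auto

lemma (in markov_process) measurable_semigroup:
  fixes f :: "'e \<Rightarrow> real"
  assumes "0 \<le> t" and [measurable]: "f \<in> borel_measurable borel"
  shows "semigroup_of P X t f \<in> borel_measurable borel"
proof -
  have [measurable]: "law_at P X t \<in> borel \<rightarrow>\<^sub>M subprob_algebra borel"
    using measurable_law[OF assms(1)] by (rule measurable_prob_algebraD)
  have "(\<lambda>x. \<integral>y. f y \<partial>law_at P X t x) \<in> borel_measurable borel"
    by (rule measurable_compose[OF _ integral_measurable_subprob_algebra]) measurable
  then show ?thesis
    using semigroup_eq_integral_law[OF assms(1,2)] by (simp cong: measurable_cong)
qed

text \<open>
  The Markov property determines the conditional expectation of \<open>f (X (s + t))\<close> given the past up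
  to time \<open>s\<close>; taking expectations on both sides yields the semigroup property.
\<close>

lemma (in markov_process) semigroup_add:
  fixes f :: "'e \<Rightarrow> real"
  assumes s: "0 \<le> s" and t: "0 \<le> t" and f [measurable]: "f \<in> borel_measurable borel"
    and bdd: "bounded (range f)"
  shows "semigroup_of P X (s + t) f x = semigroup_of P X s (semigroup_of P X t f) x"
proof -
  interpret prob_space "P x" by (rule prob)
  have X [measurable]: "X r \<in> P x \<rightarrow>\<^sub>M borel" if "0 \<le> r" for r
    using measurable_X[OF that] sets_P measurable_cong_sets by blast
  have space_P: "space (P x) = space \<Omega>"
    using sets_P by (rule sets_eq_imp_space_eq)
  have "X r -` A \<inter> space \<Omega> \<in> sets (P x)" if "0 \<le> r" "A \<in> sets borel" for r A
    using measurable_sets[OF X[OF that(1)] that(2)] by (simp add: space_P)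
  then have "subalgebra (P x) (natural_filtration \<Omega> X s)"
    unfolding subalgebra_def natural_filtration_def
    by (auto simp: space_P space_measure_of_conv sets_measure_of_conv simp flip: space_P
        intro!: sets.sigma_sets_subset)
  then interpret finite_measure_subalgebra "P x" "natural_filtration \<Omega> X s"
    by unfold_locales
  obtain B where B: "\<And>x. \<bar>f x\<bar> \<le> B"
    using bdd by (auto simp: bounded_iff)
  have int: "integrable (P x) (\<lambda>\<omega>. f (X (s + t) \<omega>))"
    using B s t by (intro integrable_const_bound[where B = B]) auto
  have [measurable]: "semigroup_of P X t f \<in> borel_measurable borel"
    by (rule measurable_semigroup[OF t f])
  have "semigroup_of P X (s + t) f x = (\<integral>\<omega>. f (X (s + t) \<omega>) \<partial>P x)"
    by (simp add: semigroup_of_def)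
  also have "\<dots> = (\<integral>\<omega>. real_cond_exp (P x) (natural_filtration \<Omega> X s) (\<lambda>\<omega>'. f (X (s + t) \<omega>')) \<omega> \<partial>P x)"
    by (rule real_cond_exp_int(2)[OF int, symmetric])
  also have "\<dots> = (\<integral>\<omega>. semigroup_of P X t f (X s \<omega>) \<partial>P x)"
    using markov[OF s t f bdd, of x] s real_cond_exp_int(1)[OF int]
    by (intro integral_cong_AE) measurable
  also have "\<dots> = semigroup_of P X s (semigroup_of P X t f) x"
    by (simp add: semigroup_of_def[of P X s])
  finally show ?thesis .
qed

abbreviation (in markov_process) tv :: "real \<Rightarrow> 'e \<Rightarrow> 'e \<Rightarrow> ennreal" where
  "tv \<equiv> optimal_coupling_distance P X discrete_dist"

text \<open>
  The coupling inequality holds for each coupling, hence for the infimum of the costs.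
\<close>

lemma (in markov_process) semigroup_diff_le_tv:
  fixes f :: "'e \<Rightarrow> real"
  assumes t: "0 \<le> t" and f: "f \<in> borel_measurable borel"
    and osc: "\<And>x y. f x - f y \<le> c"
  shows "ennreal (semigroup_of P X t f x - semigroup_of P X t f y) \<le> ennreal c * tv t x y"
proof -
  have c: "0 \<le> c" using osc[of undefined undefined] by simp
  obtain \<pi>0 where \<pi>0: "\<pi>0 \<in> couplings (law_at P X t x) (law_at P X t y)"
    using maximal_coupling[OF prob_law(1)[OF t, of x] prob_law(1)[OF t, of y]
        prob_law(2)[OF t, of x] prob_law(2)[OF t, of y]] by auto
  have per_coupling: "ennreal (semigroup_of P X t f x - semigroup_of P X t f y)
      \<le> ennreal c * (\<integral>\<^sup>+ z. ennreal (discrete_dist (fst z) (snd z)) \<partial>\<pi>)"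
    if \<pi>: "\<pi> \<in> couplings (law_at P X t x) (law_at P X t y)" for \<pi>
  proof -
    have "sets \<pi> = sets (law_at P X t x \<Otimes>\<^sub>M law_at P X t y)"
      using \<pi> by (simp add: couplings_def)
    also have "\<dots> = sets (borel \<Otimes>\<^sub>M borel)"
      using prob_law(2)[OF t] by (intro sets_pair_measure_cong)
    finally have "(\<integral>\<^sup>+ z. ennreal (discrete_dist (fst z) (snd z)) \<partial>\<pi>) = emeasure \<pi> {z. fst z \<noteq> snd z}"
      by (rule nn_integral_discrete_dist(1))
    then show ?thesis
      using coupling_inequality[OF prob_law(1,2)[OF t] prob_law(2)[OF t] \<pi> f
          bounded_range_of_osc[OF osc] osc]
      by (simp add: semigroup_eq_integral_law[OF t f])
  qed
  show ?thesis
  proof (cases "c = 0")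
    case True
    then show ?thesis using per_coupling[OF \<pi>0] by simp
  next
    case False
    then have pos: "0 < ennreal c" using c by simp
    have "ennreal (semigroup_of P X t f x - semigroup_of P X t f y) / ennreal c \<le> tv t x y"
      unfolding optimal_coupling_distance_def
      by (intro INF_greatest divide_le_posI_ennreal[OF pos] per_coupling)
    then have "ennreal c * (ennreal (semigroup_of P X t f x - semigroup_of P X t f y) / ennreal c)
        \<le> ennreal c * tv t x y"
      by (rule mult_left_mono) simp
    moreover have "ennreal c * (d / ennreal c) = d" for d
      using pos by (simp add: ennreal_times_divide ennreal_mult_divide_eq mult.commute[of "ennreal c"])
    ultimately show ?thesis by simp
  qed
qed

lemma (in markov_process) tv_le_semigroup_diff:
  assumes t: "0 \<le> t"
  obtains Y where "Y \<in> sets borel"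
    "tv t x y \<le> ennreal (semigroup_of P X t (indicator Y) x - semigroup_of P X t (indicator Y) y)"
proof -
  obtain Y \<pi> where Y: "Y \<in> sets borel" and \<pi>: "\<pi> \<in> couplings (law_at P X t x) (law_at P X t y)"
    and le: "emeasure \<pi> {z. fst z \<noteq> snd z}
      \<le> ennreal (measure (law_at P X t x) Y - measure (law_at P X t y) Y)"
    using maximal_coupling[OF prob_law(1)[OF t, of x] prob_law(1)[OF t, of y]
        prob_law(2)[OF t, of x] prob_law(2)[OF t, of y]] by auto
  have "sets \<pi> = sets (law_at P X t x \<Otimes>\<^sub>M law_at P X t y)"
    using \<pi> by (simp add: couplings_def)
  also have "\<dots> = sets (borel \<Otimes>\<^sub>M borel)"
    using prob_law(2)[OF t] by (intro sets_pair_measure_cong)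
  finally have "tv t x y \<le> emeasure \<pi> {z. fst z \<noteq> snd z}"
    unfolding optimal_coupling_distance_def
    using \<pi> by (intro INF_lower2[OF \<pi>]) (simp add: nn_integral_discrete_dist(1))
  also note le
  finally show ?thesis
    unfolding semigroup_indicator_eq_measure[OF t Y, symmetric]
    using Y that by blast
qed

text \<open>
  The step that makes contraction of the semigroup visible in the coupling distance: choose \<open>Y\<close>
  extremal at time \<open>s + t\<close>, write its semigroup image as \<open>S_s\<close> applied to \<open>S_t (indicator Y)\<close>, and
  apply the coupling inequality at time \<open>s\<close> to the latter function, whose oscillation is at most \<open>c\<close>.
\<close>

lemma (in markov_process) tv_add_le:
  assumes s: "0 \<le> s" and t: "0 \<le> t"
    and contr: "\<And>Y x y. Y \<in> sets borel \<Longrightarrow>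
      semigroup_of P X t (indicator Y) x - semigroup_of P X t (indicator Y) y \<le> c"
  shows "tv (s + t) x y \<le> ennreal c * tv s x y"
proof -
  have "0 \<le> s + t" using s t by simp
  then obtain Y where Y: "Y \<in> sets borel"
    and le: "tv (s + t) x y
      \<le> ennreal (semigroup_of P X (s + t) (indicator Y) x - semigroup_of P X (s + t) (indicator Y) y)"
    by (rule tv_le_semigroup_diff)
  have "semigroup_of P X (s + t) (indicator Y) z
      = semigroup_of P X s (semigroup_of P X t (indicator Y)) z" for z
    using Y by (intro semigroup_add s t) (auto simp: bounded_iff indicator_def intro!: exI[of _ 1])
  then show ?thesis
    using le semigroup_diff_le_tv[OF s measurable_semigroup[OF t] contr[OF Y], of x y] Y
    by (metis borel_measurable_indicator order_trans)
qed

lemma (in markov_process) semigroup_indicator_bounds: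
  assumes t: "0 \<le> t" and Y: "Y \<in> sets borel"
  shows "0 \<le> semigroup_of P X t (indicator Y) x" "semigroup_of P X t (indicator Y) x \<le> 1"
proof -
  interpret prob_space "law_at P X t x" using prob_law t by blast
  show "0 \<le> semigroup_of P X t (indicator Y) x" "semigroup_of P X t (indicator Y) x \<le> 1"
    by (simp_all add: semigroup_indicator_eq_measure[OF t Y])
qed

lemma (in markov_process) tv_le_1:
  assumes t: "0 \<le> t"
  shows "tv t x y \<le> 1"
proof -
  obtain Y where Y: "Y \<in> sets borel" and le:
    "tv t x y \<le> ennreal (semigroup_of P X t (indicator Y) x - semigroup_of P X t (indicator Y) y)"
    using tv_le_semigroup_diff[OF t] by blast
  note le
  also have "\<dots> \<le> ennreal 1"
    using semigroup_indicator_bounds(2)[OF t Y, of x] semigroup_indicator_bounds(1)[OF t Y, of y]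
    by (intro ennreal_leI) linarith
  finally show ?thesis by simp
qed

lemma (in markov_process) tv_antimono:
  assumes "0 \<le> s" "s \<le> t"
  shows "tv t x y \<le> tv s x y"
proof -
  have ts: "0 \<le> t - s" using assms by simp
  have "tv (s + (t - s)) x y \<le> ennreal 1 * tv s x y"
  proof (rule tv_add_le[OF assms(1) ts])
    fix Y :: "'e set" and x y assume Y: "Y \<in> sets borel"
    show "semigroup_of P X (t - s) (indicator Y) x - semigroup_of P X (t - s) (indicator Y) y \<le> 1"
      using semigroup_indicator_bounds(2)[OF ts Y, of x] semigroup_indicator_bounds(1)[OF ts Y, of y]
      by linarith
  qed
  then show ?thesis by simp
qed

text \<open>
  An indicator is an admissible test function of oscillation \<open>1\<close>, unless it is constant. In that
  case the semigroup fixes it and the difference is \<open>0\<close>; this also covers the one-point space.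
\<close>

lemma (in markov_process) semigroup_indicator_diff_le_osc_norm:
  assumes t: "0 \<le> t" and Y: "Y \<in> sets borel"
    and c: "osc_norm (semigroup_of P X t) \<le> ennreal c" "0 \<le> c"
  shows "semigroup_of P X t (indicator Y) x - semigroup_of P X t (indicator Y) y \<le> c"
proof (cases "Y = {} \<or> Y = UNIV")
  case True
  then have "semigroup_of P X t (indicator Y) x = semigroup_of P X t (indicator Y) y"
    using prob_space.prob_space[OF prob] by (auto simp: semigroup_of_def)
  then show ?thesis using c by simp
next
  case False
  then obtain a b where ab: "a \<in> Y" "b \<notin> Y" by auto
  have "osc (indicator Y) = 1"
  proof (rule antisym)
    have "osc (indicator Y) \<le> ennreal 1"
      unfolding osc_le_iff by (auto simp: indicator_def)
    then show "osc (indicator Y) \<le> 1" by simp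
    have "ennreal (indicator Y a - indicator Y b) \<le> osc (indicator Y)"
      unfolding osc_def by (intro SUP_upper2[of a] SUP_upper2[of b]) auto
    then show "1 \<le> osc (indicator Y)" using ab by simp
  qed
  then have "osc (semigroup_of P X t (indicator Y)) \<le> osc_norm (semigroup_of P X t)"
    unfolding osc_norm_def using Y by (intro SUP_upper) auto
  also note c(1)
  finally show ?thesis
    using c(2) by (auto simp: osc_le_iff dest!: spec[of _ x] spec[of _ y])
qed

section \<open>The equivalence\<close>

text \<open>
  Markov's inequality in time: since \<open>tv\<close> is nonincreasing, \<open>T * tv T x y\<close> is at most the coupling
  time.
\<close>

lemma (in markov_process) osc_norm_less_1_if_bounded_coupling_time:
  assumes M: "\<And>x y. generalized_coupling_time P X discrete_dist x y \<le> ennreal M"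
  shows "\<exists>T>0. osc_norm (semigroup_of P X T) < 1"
proof (intro exI conjI)
  \<comment> \<open>Any \<open>T > 0\<close> with \<open>T \<ge> 2 * M\<close> works; \<open>M\<close> itself may be negative.\<close>
  define T where "T = 2 * \<bar>M\<bar> + 1"
  show T: "0 < T" by (simp add: T_def)
  have half: "tv T x y \<le> ennreal (1 / 2)" for x y
  proof -
    have "tv T x y * ennreal T = (\<integral>\<^sup>+ t. tv T x y * indicator {0..T} t \<partial>lborel)"
      using T by (subst nn_integral_cmult_indicator) auto
    also have "\<dots> \<le> (\<integral>\<^sup>+ t \<in> {0..}. tv t x y \<partial>lborel)"
      by (intro nn_integral_mono) (auto simp: indicator_def intro: tv_antimono)
    also have "\<dots> \<le> ennreal M"
      using M by (simp add: generalized_coupling_time_def)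
    also have "\<dots> \<le> ennreal (1 / 2 * T)"
      by (intro ennreal_leI) (simp add: T_def)
    also have "\<dots> = ennreal (1 / 2) * ennreal T"
      using T by (intro ennreal_mult) auto
    finally show ?thesis
      using T by (simp add: mult.commute[of _ "ennreal T"] ennreal_mult_le_mult_iff)
  qed
  have "osc_norm (semigroup_of P X T) \<le> ennreal (1 / 2)"
    unfolding osc_norm_def
  proof (rule SUP_least, clarify)
    fix f :: "'e \<Rightarrow> real" assume f: "f \<in> borel_measurable borel" and "osc f = 1"
    then have "osc f \<le> ennreal 1" by simp
    then have osc: "f x - f y \<le> 1" for x y
      unfolding osc_le_iff by simp
    show "osc (semigroup_of P X T f) \<le> ennreal (1 / 2)"
      unfolding osc_le_iff
    proof (intro allI)
      fix x y
      have "ennreal (semigroup_of P X T f x - semigroup_of P X T f y) \<le> ennreal 1 * tv T x y"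
        using T by (intro semigroup_diff_le_tv f osc) auto
      also have "\<dots> \<le> ennreal (1 / 2)"
        using half by simp
      finally show "ennreal (semigroup_of P X T f x - semigroup_of P X T f y) \<le> ennreal (1 / 2)" .
    qed
  qed
  also have "\<dots> < ennreal 1"
    by (subst ennreal_less_iff) auto
  finally show "osc_norm (semigroup_of P X T) < 1" by simp
qed

text \<open>
  On the \<open>n\<close>-th interval of length \<open>T\<close> the distance \<open>tv\<close> is at most its value \<open>\<le> c ^ n\<close> at the left
  end point. Dominating \<open>tv\<close> by the resulting step function bounds the coupling time by
  \<open>T / (1 - c)\<close>.
\<close>

lemma (in markov_process) bounded_coupling_time_if_osc_norm_less_1:
  assumes T: "0 < T" and norm: "osc_norm (semigroup_of P X T) < 1"
  shows "\<exists>M::real. \<forall>x y. generalized_coupling_time P X discrete_dist x y \<le> ennreal M"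
proof -
  obtain c where c: "0 \<le> c" "osc_norm (semigroup_of P X T) = ennreal c"
    using norm by (cases "osc_norm (semigroup_of P X T)") auto
  with norm have c1: "c < 1" by simp
  have contr: "semigroup_of P X T (indicator Y) x - semigroup_of P X T (indicator Y) y \<le> c"
    if "Y \<in> sets borel" for Y x y
    using T c that by (intro semigroup_indicator_diff_le_osc_norm) auto
  have geom: "tv (real n * T) x y \<le> ennreal (c ^ n)" for n x y
  proof (induction n)
    case 0
    show ?case using tv_le_1[of 0] by simp
  next
    case (Suc n)
    have "tv (real (Suc n) * T) x y = tv (real n * T + T) x y"
      by (simp add: algebra_simps)
    also have "\<dots> \<le> ennreal c * tv (real n * T) x y"
      using T contr by (intro tv_add_le) auto
    also have "\<dots> \<le> ennreal c * ennreal (c ^ n)"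
      by (intro mult_left_mono Suc.IH) auto
    also have "\<dots> = ennreal (c ^ Suc n)"
      using c by (simp add: ennreal_mult)
    finally show ?case .
  qed
  define I where "I n = {real n * T ..< real n * T + T}" for n
  have "generalized_coupling_time P X discrete_dist x y \<le> ennreal (T * (1 / (1 - c)))" for x y
  proof -
    have "generalized_coupling_time P X discrete_dist x y
        \<le> (\<integral>\<^sup>+ t. (\<Sum>n. ennreal (c ^ n) * indicator (I n) t) \<partial>lborel)"
      unfolding generalized_coupling_time_def
    proof (rule nn_integral_mono)
      fix t :: real
      show "tv t x y * indicator {0..} t \<le> (\<Sum>n. ennreal (c ^ n) * indicator (I n) t)"
      proof (cases "0 \<le> t")
        case True
        define n where "n = nat \<lfloor>t / T\<rfloor>"
        have n: "real n = of_int \<lfloor>t / T\<rfloor>"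
          using True T by (simp add: n_def)
        have "real n \<le> t / T" "t / T < real n + 1"
          unfolding n by linarith+
        then have bounds: "real n * T \<le> t" "t < real n * T + T"
          using T by (simp_all add: field_simps)
        have "tv t x y \<le> tv (real n * T) x y"
          using bounds T by (intro tv_antimono) auto
        also have "\<dots> \<le> ennreal (c ^ n)"
          by (rule geom)
        also have "\<dots> = (\<Sum>k\<in>{n}. ennreal (c ^ k) * indicator (I k) t)"
          using bounds by (simp add: I_def)
        also have "\<dots> \<le> (\<Sum>n. ennreal (c ^ n) * indicator (I n) t)"
          by (intro sum_le_suminf) auto
        finally show ?thesis using True by simp
      qed simp
    qed
    also have "\<dots> = (\<Sum>n. \<integral>\<^sup>+ t. ennreal (c ^ n) * indicator (I n) t \<partial>lborel)"
      by (intro nn_integral_suminf) (simp add: I_def)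
    also have "\<dots> = (\<Sum>n. ennreal (T * c ^ n))"
    proof (intro arg_cong[where f = suminf] ext)
      fix n
      have "(\<integral>\<^sup>+ t. ennreal (c ^ n) * indicator (I n) t \<partial>lborel) = ennreal (c ^ n) * ennreal T"
        using T by (subst nn_integral_cmult_indicator) (auto simp: I_def)
      then show "(\<integral>\<^sup>+ t. ennreal (c ^ n) * indicator (I n) t \<partial>lborel) = ennreal (T * c ^ n)"
        using T c by (simp add: ennreal_mult mult.commute)
    qed
    also have "\<dots> = ennreal (T * (1 / (1 - c)))"
      using T c c1 by (intro suminf_ennreal_eq sums_mult geometric_sums) auto
    finally show ?thesis .
  qed
  then show ?thesis by blast
qed

theorem corollary3p10:
  fixes \<Omega> :: "'w measure"
    and P :: "'e::polish_space \<Rightarrow> 'w measure"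
    and X :: "real \<Rightarrow> 'w \<Rightarrow> 'e"
  assumes "feller_process \<Omega> P X"
  shows "(\<exists>M::real. \<forall>x y. generalized_coupling_time P X discrete_dist x y \<le> ennreal M)
     \<longleftrightarrow> (\<exists>T>0. osc_norm (semigroup_of P X T) < 1)"
proof -
  interpret feller_process \<Omega> P X by fact
  show ?thesis
    using osc_norm_less_1_if_bounded_coupling_time bounded_coupling_time_if_osc_norm_less_1
    by blast
qed

end
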